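(* Let $(t_n)_{n\ge1}$ be a sequence of positive integers and $(w_n)_{n\ge1}$ a sequence of positive real numbers such that $w_n/t_n\to0$ as $n\to\infty$. Let $p:\mathbb{R}\to[0,1]$ be a weakly decreasing function (not necessarily continuous) such that $p(x)\to1$ as $x\to-\infty$ and $p(x)\to0$ as $x\to+\infty$. Then there exists a sequence $((X^{(n)}_t)_{t\in\mathbb{N}})_{n\ge1}$ of discrete time ergodic Markov chains on finite state spaces such that $$\sup_{c\in\mathbb{R}\,:\,t_n+cw_n\in\mathbb{N}}\left|\mathrm{d}^{(n)}(t_n+cw_n)-p(c)\right|\xrightarrow[n\to\infty]{}0,$$ where $\mathrm{d}^{(n)}(\cdot)$ denotes the worst-case total variation distance to stationarity of the chain $(X^{(n)}_t)_{t\in\mathbb{N}}$.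
   Context: $\mathbb{N}=\{0,1,2,\ldots\}$. For an ergodic (irreducible and aperiodic) Markov chain $(X_t)_{t\ge0}$ on a finite state space $S$ with stationary distribution $\pi$, let $\mu_{x,t}$ be the law of $X_t$ conditioned on $X_0=x$. The distance to stationarity is $\mathrm{d}(t)=\max_{x\in S}\mathrm{d}_{TV}(\mu_{x,t},\pi)$, where $\mathrm{d}_{TV}(\mu,\nu)=\max_{A\subset S}|\mu(A)-\nu(A)|=\frac12\sum_{x\in S}|\mu(x)-\nu(x)|$. State spaces may depend on $n$. *)

theory Defs
  imports "HOL-Probability.Probability"
begin

text \<open>A discrete time Markov chain is given by its finite state space \<open>S\<close> and its transition
  kernel \<open>K\<close>. The values of \<open>K\<close> outside \<open>S\<close> are irrelevant.\<close>

definition markov_kernel :: "'a set \<Rightarrow> ('a \<Rightarrow> 'a pmf) \<Rightarrow> bool" where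
  "markov_kernel S K \<longleftrightarrow> finite S \<and> S \<noteq> {} \<and> (\<forall>x\<in>S. set_pmf (K x) \<subseteq> S)"

text \<open>\<open>law K x t\<close> is the law of \<open>X\<^sub>t\<close> conditioned on \<open>X\<^sub>0 = x\<close>.\<close>

primrec law :: "('a \<Rightarrow> 'a pmf) \<Rightarrow> 'a \<Rightarrow> nat \<Rightarrow> 'a pmf" where
  "law K x 0 = return_pmf x"
| "law K x (Suc t) = bind_pmf (law K x t) K"

definition irreducible_chain :: "'a set \<Rightarrow> ('a \<Rightarrow> 'a pmf) \<Rightarrow> bool" where
  "irreducible_chain S K \<longleftrightarrow> (\<forall>x\<in>S. \<forall>y\<in>S. \<exists>t. pmf (law K x t) y > 0)"

definition aperiodic_chain :: "'a set \<Rightarrow> ('a \<Rightarrow> 'a pmf) \<Rightarrow> bool" where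
  "aperiodic_chain S K \<longleftrightarrow> (\<forall>x\<in>S. Gcd {t. t \<ge> 1 \<and> pmf (law K x t) x > 0} = 1)"

definition ergodic_chain :: "'a set \<Rightarrow> ('a \<Rightarrow> 'a pmf) \<Rightarrow> bool" where
  "ergodic_chain S K \<longleftrightarrow> markov_kernel S K \<and> irreducible_chain S K \<and> aperiodic_chain S K"

definition stationary_distribution :: "'a set \<Rightarrow> ('a \<Rightarrow> 'a pmf) \<Rightarrow> 'a pmf \<Rightarrow> bool" where
  "stationary_distribution S K \<pi> \<longleftrightarrow> set_pmf \<pi> \<subseteq> S \<and> bind_pmf \<pi> K = \<pi>"

definition tv_dist :: "'a set \<Rightarrow> 'a pmf \<Rightarrow> 'a pmf \<Rightarrow> real" where
  "tv_dist S \<mu> \<nu> = (MAX A\<in>Pow S. \<bar>measure_pmf.prob \<mu> A - measure_pmf.prob \<nu> A\<bar>)"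

text \<open>An ergodic chain has exactly one stationary distribution, so it is harmless to pass it as
  the argument \<open>\<pi>\<close>.\<close>

definition dist_to_stationarity ::
  "'a set \<Rightarrow> ('a \<Rightarrow> 'a pmf) \<Rightarrow> 'a pmf \<Rightarrow> nat \<Rightarrow> real" where
  "dist_to_stationarity S K \<pi> t = (MAX x\<in>S. tv_dist S (law K x t) \<pi>)"

end

theory Submission
  imports Defs
begin

text \<open>The chains are success runs on \<open>{0..m}\<close>: from \<open>i\<close> the chain moves to \<open>i + 1\<close> with
  probability \<open>u (i + 1) / u i\<close> and falls back to \<open>0\<close> otherwise. The stationary distribution is
  proportional to \<open>u\<close>. Take \<open>u 0 = 1\<close> and \<open>u (i + 1) = \<epsilon> q i\<close> with a tiny \<open>\<epsilon>\<close>. Then the stationary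
  distribution is almost a point mass at \<open>0\<close>, and the distance to it from a state is essentially
  the probability of having run without a fall: this is \<open>q s\<close> when starting from \<open>1\<close>, and
  \<open>q (j + s) / q j\<close> when starting from \<open>j + 1\<close>. For \<open>q s = p ((s - t) / w)\<close>, cut off to \<open>0\<close> after
  time \<open>3 t / 2\<close>, the start \<open>j = 0\<close> is nearly the worst one.\<close>

section \<open>Laws of a general chain and bounds on total variation\<close>

lemma law_add: "law K x (s + t) = bind_pmf (law K x s) (\<lambda>y. law K y t)"
proof (induction t)
  case 0
  then show ?case by (simp add: bind_return_pmf')
next
  case (Suc t)
  then show ?case by (simp add: bind_assoc_pmf)
qed

lemma law_Suc_left: "law K x (Suc t) = bind_pmf (K x) (\<lambda>y. law K y t)"
  using law_add[of K x 1 t] by (simp add: bind_return_pmf)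

lemma set_law_trans:
  assumes "y \<in> set_pmf (law K x s)" "z \<in> set_pmf (law K y t)"
  shows "z \<in> set_pmf (law K x (s + t))"
  using assms by (auto simp: law_add)

lemma stationary_law:
  assumes "stationary_distribution S K \<pi>"
  shows "bind_pmf \<pi> (\<lambda>x. law K x t) = \<pi>"
proof (induction t)
  case 0
  then show ?case by (simp add: bind_return_pmf')
next
  case (Suc t)
  then show ?case
    using assms by (simp add: bind_assoc_pmf[symmetric] stationary_distribution_def)
qed

lemma prob_bind_pmf:
  "measure_pmf.prob (bind_pmf M f) A = measure_pmf.expectation M (\<lambda>x. measure_pmf.prob (f x) A)"
  by (simp add: measure_pmf_bind)
     (rule measure_pmf.measure_bind[where N="count_space UNIV"], auto simp: space_subprob_algebra intro: measure_pmf.subprob_space_axioms)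

text \<open>By stationarity \<pi> is the \<pi>-average over starts \<open>y\<close> of the laws at
  time \<open>t\<close>, so the difference is an average of terms that vanish at
  \<open>y = x\<close> and are at most 1 elsewhere. The bound is uniform in \<open>t\<close>; it is
  used at \<open>x = 0\<close>, which carries almost all the mass.\<close>

lemma prob_law_stationary_diff_le:
  assumes "stationary_distribution S K \<pi>"
  shows "\<bar>measure_pmf.prob (law K x t) A - measure_pmf.prob \<pi> A\<bar> \<le> 1 - pmf \<pi> x"
proof -
  define g where "g y = measure_pmf.prob (law K y t) A" for y
  have g: "g y \<in> {0..1}" for y by (simp add: g_def)
  have int: "integrable (measure_pmf \<pi>) g"
    by (rule measure_pmf.integrable_const_bound[where B=1]) (auto simp: g_def)
  have "g x - measure_pmf.prob \<pi> A = g x - measure_pmf.expectation \<pi> g"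
    using prob_bind_pmf[of \<pi> "\<lambda>y. law K y t" A] stationary_law[OF assms, of t]
    by (simp add: g_def[abs_def])
  also have "\<dots> = measure_pmf.expectation \<pi> (\<lambda>y. g x - g y)"
    using int by simp
  also have "\<bar>\<dots>\<bar> \<le> measure_pmf.expectation \<pi> (\<lambda>y. \<bar>g x - g y\<bar>)"
    by (rule integral_abs_bound)
  also have "\<dots> \<le> measure_pmf.expectation \<pi> (indicator (- {x}))"
  proof (rule integral_mono)
    show "\<bar>g x - g y\<bar> \<le> indicator (- {x}) y" for y
      using g[of x] g[of y] by (auto simp: indicator_def abs_if)
  qed (use int in \<open>auto simp: measure_pmf.emeasure_eq_measure\<close>)
  also have "\<dots> = 1 - pmf \<pi> x"
    using measure_pmf.prob_compl[of "{x}" \<pi>] by (simp add: Compl_eq_Diff_UNIV pmf.rep_eq)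
  finally show ?thesis by (simp add: g_def)
qed

lemma tv_dist_le:
  assumes "finite S" "\<And>A. \<bar>measure_pmf.prob \<mu> A - measure_pmf.prob \<nu> A\<bar> \<le> B"
  shows "tv_dist S \<mu> \<nu> \<le> B"
  unfolding tv_dist_def using assms by (subst Max_le_iff) auto

lemma tv_dist_ge:
  assumes "finite S" "A \<subseteq> S"
  shows "\<bar>measure_pmf.prob \<mu> A - measure_pmf.prob \<nu> A\<bar> \<le> tv_dist S \<mu> \<nu>"
  unfolding tv_dist_def using assms by (intro Max_ge) auto

lemma dist_to_stationarity_le:
  assumes "finite S" "S \<noteq> {}" "\<And>x. x \<in> S \<Longrightarrow> tv_dist S (law K x t) \<pi> \<le> B"
  shows "dist_to_stationarity S K \<pi> t \<le> B"
  unfolding dist_to_stationarity_def using assms by (subst Max_le_iff) auto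

lemma dist_to_stationarity_ge:
  assumes "finite S" "x \<in> S"
  shows "tv_dist S (law K x t) \<pi> \<le> dist_to_stationarity S K \<pi> t"
  unfolding dist_to_stationarity_def using assms by (intro Max_ge) auto

section \<open>The success-run chain: stationary law and ergodicity\<close>

locale run_chain =
  fixes u :: "nat \<Rightarrow> real" and m :: nat
  assumes u_0: "u 0 = 1" and u_1: "u 1 < 1" and m_pos: "m \<ge> 1"
    and u_antimono: "antimono u"
    and u_pos: "\<And>i. i \<le> m \<Longrightarrow> u i > 0"
    and u_zero: "\<And>i. i > m \<Longrightarrow> u i = 0"
begin

text \<open>The top state needs no separate case: \<open>u (Suc m) = 0\<close> makes the fall from
  \<open>m\<close> certain.\<close>

definition step :: "nat \<Rightarrow> nat pmf" where
  "step x = map_pmf (\<lambda>b. if b then Suc x else 0) (bernoulli_pmf (u (Suc x) / u x))"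

definition total :: real where "total = (\<Sum>i\<le>m. u i)"

definition stat :: "nat pmf" where "stat = embed_pmf (\<lambda>i. u i / total)"

lemma u_nonneg: "u i \<ge> 0"
  using u_pos[of i] u_zero[of i] by (cases "i \<le> m") auto

lemma ratio_bounds: "0 \<le> u (Suc x) / u x" "u (Suc x) / u x \<le> 1"
  using u_nonneg[of x] u_nonneg[of "Suc x"] antimonoD[OF u_antimono, of x "Suc x"]
  by (auto simp: divide_le_eq)

lemma total_ge_1: "total \<ge> 1"
proof -
  have "(\<Sum>i\<in>{0}. u i) \<le> total"
    unfolding total_def by (rule sum_mono2) (auto simp: u_nonneg)
  then show ?thesis by (simp add: u_0)
qed

lemma pmf_stat: "pmf stat i = u i / total"
proof -
  have "(\<integral>\<^sup>+i. ennreal (u i / total) \<partial>count_space UNIV) = (\<Sum>i\<le>m. ennreal (u i / total))"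
    by (rule nn_integral_count_space') (auto simp: u_zero not_le)
  also have "\<dots> = ennreal (\<Sum>i\<le>m. u i / total)"
    using total_ge_1 by (intro sum_ennreal) (auto simp: u_nonneg)
  also have "(\<Sum>i\<le>m. u i / total) = 1"
    using total_ge_1 by (simp add: sum_divide_distrib[symmetric] total_def[symmetric])
  finally show ?thesis
    unfolding stat_def using total_ge_1 by (intro pmf_embed_pmf) (auto simp: u_nonneg)
qed

lemma set_stat: "set_pmf stat \<subseteq> {..m}"
proof
  fix i assume "i \<in> set_pmf stat"
  then show "i \<in> {..m}" using u_zero[of i] by (cases "i \<le> m") (auto simp: set_pmf_eq pmf_stat)
qed

lemma pmf_step:
  "pmf (step x) y = (if y = 0 then 1 - u (Suc x) / u x else if y = Suc x then u (Suc x) / u x else 0)"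
proof -
  have "pmf (step x) y = measure_pmf.prob (bernoulli_pmf (u (Suc x) / u x) \<bind>
      (\<lambda>b. return_pmf (if b then Suc x else 0))) {y}"
    by (simp add: step_def map_pmf_def pmf.rep_eq)
  then show ?thesis
    using ratio_bounds[of x] unfolding prob_bind_pmf
    by (auto simp: integral_bernoulli_pmf indicator_def)
qed

lemma set_step: "set_pmf (step x) \<subseteq> {0, Suc x}"
  by (auto simp: step_def)

lemma Suc_in_step: "x < m \<Longrightarrow> Suc x \<in> set_pmf (step x)"
  using u_pos[of x] u_pos[of "Suc x"] by (auto simp: set_pmf_eq pmf_step)

lemma zero_in_step: "x = 0 \<or> x = m \<Longrightarrow> 0 \<in> set_pmf (step x)"
  using u_0 u_1 u_zero[of "Suc m"] by (auto simp: set_pmf_eq pmf_step)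

lemma markov: "markov_kernel {..m} step"
proof -
  have "set_pmf (step x) \<subseteq> {..m}" if "x \<le> m" for x
  proof (cases "x = m")
    case True
    then show ?thesis using u_zero[of "Suc m"] by (auto simp: set_pmf_eq pmf_step split: if_splits)
  next
    case False
    then show ?thesis using set_step[of x] that by auto
  qed
  then show ?thesis by (auto simp: markov_kernel_def)
qed

lemma climb: "x + k \<le> m \<Longrightarrow> x + k \<in> set_pmf (law step x k)"
proof (induction k)
  case (Suc k)
  then show ?case using Suc_in_step[of "x + k"] by auto
qed simp

lemma reach_zero: "x \<le> m \<Longrightarrow> 0 \<in> set_pmf (law step x (Suc (m - x)))"
  using climb[of x "m - x"] zero_in_step[of m] by auto

lemma ergodic: "ergodic_chain {..m} step"
proof -
  have reach: "y \<in> set_pmf (law step x (Suc (m - x) + y))" if "x \<le> m" "y \<le> m" for x y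
    using set_law_trans[OF reach_zero[OF that(1)], of y y] climb[of 0 y] that by simp
  have "Gcd {t. t \<ge> 1 \<and> pmf (law step x t) x > 0} = 1" (is "Gcd ?T = 1") if "x \<le> m" for x
  proof -
    \<comment> \<open>A loop \<open>x\<close>, \<open>m\<close>, \<open>0\<close>, \<open>x\<close>
      can be lengthened by one step spent at \<open>0\<close>, where \<open>u 1 < 1\<close> allows
      the chain to stay. Two consecutive return times force the gcd to be 1.\<close>
    have "0 \<in> set_pmf (law step x (Suc (m - x) + 1))"
      using set_law_trans[OF reach_zero[OF that], of 0 1] zero_in_step[of 0]
      by (simp add: bind_return_pmf)
    then have "x \<in> set_pmf (law step x (Suc (m - x) + 1 + x))"
      by (rule set_law_trans) (use climb[of 0 x] that in simp)
    then have 1: "Suc (m - x) + x + 1 \<in> ?T" by (simp add: pmf_positive add_ac)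
    have 2: "Suc (m - x) + x \<in> ?T" using reach[OF that that] by (simp add: pmf_positive)
    have "Gcd ?T dvd (Suc (m - x) + x + 1) - (Suc (m - x) + x)"
      using 1 2 by (intro dvd_diff_nat Gcd_dvd)
    then show ?thesis by simp
  qed
  then show ?thesis
    using markov pmf_positive[OF reach]
    unfolding ergodic_chain_def irreducible_chain_def aperiodic_chain_def by blast
qed

text \<open>State \<open>z + 1\<close> is entered only from \<open>z\<close>, which passes on
  exactly the weight \<open>u (z + 1)\<close>. The weights \<open>u x - u (x + 1)\<close> that fall
  to \<open>0\<close> telescope to \<open>u 0\<close>.\<close>

lemma stationary: "stationary_distribution {..m} step stat"
proof -
  have "pmf (bind_pmf stat step) y = pmf stat y" for y
  proof -
    have *: "pmf (bind_pmf stat step) y = (\<Sum>x\<le>m. pmf stat x * pmf (step x) y)"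
      using set_stat by (subst pmf_bind, subst integral_measure_pmf_real[of "{..m}"]) (auto simp: mult.commute)
    show ?thesis
    proof (cases y)
      case 0
      have "(\<Sum>x\<le>m. pmf stat x * pmf (step x) 0) = (\<Sum>x\<le>m. (u x - u (Suc x)) / total)"
        using u_pos by (intro sum.cong) (force simp: pmf_stat pmf_step field_simps)+
      also have "\<dots> = (u 0 - u (Suc m)) / total"
        by (simp add: sum_divide_distrib[symmetric] sum_telescope)
      finally show ?thesis using * 0 u_zero[of "Suc m"] by (simp add: pmf_stat)
    next
      case (Suc z)
      have "(\<Sum>x\<le>m. pmf stat x * pmf (step x) y) = (\<Sum>x\<le>m. if z = x then u (Suc x) / total else 0)"
        using u_pos Suc by (intro sum.cong) (force simp: pmf_stat pmf_step field_simps)+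
      also have "\<dots> = u y / total"
        using u_zero[of y] Suc by auto
      finally show ?thesis using * by (simp add: pmf_stat)
    qed
  qed
  then show ?thesis
    using set_stat by (auto simp: stationary_distribution_def intro: pmf_eqI)
qed

section \<open>Distance to stationarity of the success runs\<close>

lemma prob_law_Suc:
  "measure_pmf.prob (law step x (Suc s)) A
    = u (Suc x) / u x * measure_pmf.prob (law step (Suc x) s) A
      + (1 - u (Suc x) / u x) * measure_pmf.prob (law step 0 s) A"
  using ratio_bounds[of x]
  by (simp add: law_Suc_left prob_bind_pmf step_def integral_map_pmf integral_bernoulli_pmf
      del: law.simps)

lemma ratio_step: "u (Suc x) / u x * (u (Suc x + s) / u (Suc x)) = u (x + Suc s) / u x"
  if "x \<le> m"
proof (cases "Suc x \<le> m")
  case True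
  then show ?thesis using u_pos[of "Suc x"] by simp
next
  case False
  then show ?thesis by (simp add: u_zero)
qed

text \<open>The ratio \<open>u (x + s) / u x\<close> is the probability of no fall within
  \<open>s\<close> steps. After a fall the chain restarts from \<open>0\<close>, whose law stays
  within \<open>1 - pmf stat 0\<close> of \<open>stat\<close> at all times, so the time of the fall
  does not matter. The induction conditions on the first step.\<close>

lemma prob_law_upper:
  "x \<le> m \<Longrightarrow> \<bar>measure_pmf.prob (law step x s) A - measure_pmf.prob stat A\<bar>
    \<le> u (x + s) / u x + (1 - pmf stat 0)"
proof (induction s arbitrary: x)
  case 0
  have "\<bar>measure_pmf.prob (law step x 0) A - measure_pmf.prob stat A\<bar> \<le> 1"
    using measure_pmf.prob_le_1[of "law step x 0" A] measure_pmf.prob_le_1[of stat A]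
      measure_nonneg[of "law step x 0" A] measure_nonneg[of stat A] by linarith
  then show ?case using u_pos[OF 0] pmf_le_1[of stat 0] by simp
next
  case (Suc s)
  define b where "b = u (Suc x) / u x"
  define f where "f y = measure_pmf.prob (law step y s) A - measure_pmf.prob stat A" for y
  have b: "0 \<le> b" "b \<le> 1" using ratio_bounds[of x] by (auto simp: b_def)
  have "b * \<bar>f (Suc x)\<bar> \<le> b * (u (Suc x + s) / u (Suc x) + (1 - pmf stat 0))"
  proof (cases "Suc x \<le> m")
    case True
    show ?thesis unfolding f_def using b(1) by (intro mult_left_mono Suc.IH True)
  qed (simp add: b_def u_zero)
  moreover have "(1 - b) * \<bar>f 0\<bar> \<le> (1 - b) * (1 - pmf stat 0)"
    unfolding f_def using b(2) by (intro mult_left_mono prob_law_stationary_diff_le[OF stationary]) auto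
  moreover have "b * (u (Suc x + s) / u (Suc x)) = u (x + Suc s) / u x"
    unfolding b_def using ratio_step Suc.prems by blast
  moreover have "measure_pmf.prob (law step x (Suc s)) A - measure_pmf.prob stat A
      = b * f (Suc x) + (1 - b) * f 0"
    unfolding prob_law_Suc by (simp add: b_def[symmetric] f_def algebra_simps)
  moreover have "\<bar>b * f (Suc x) + (1 - b) * f 0\<bar> \<le> b * \<bar>f (Suc x)\<bar> + (1 - b) * \<bar>f 0\<bar>"
    using b by (intro order_trans[OF abs_triangle_ineq]) (simp add: abs_mult)
  ultimately show ?case by (simp add: algebra_simps del: law.simps)
qed

text \<open>A run without a fall ends in \<open>x + s\<close>, and its step probabilities telescope.
  The contribution of a first-step fall is nonnegative and is dropped.\<close>

lemma pmf_law_lower: "x \<le> m \<Longrightarrow> u (x + s) / u x \<le> pmf (law step x s) (x + s)"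
proof (induction s arbitrary: x)
  case 0
  then show ?case using u_pos[of x] by simp
next
  case (Suc s)
  define b where "b = u (Suc x) / u x"
  have b: "0 \<le> b" "b \<le> 1" using ratio_bounds[of x] by (auto simp: b_def)
  have "u (x + Suc s) / u x = b * (u (Suc x + s) / u (Suc x))"
    unfolding b_def using ratio_step[OF Suc.prems, of s] by simp
  also have "\<dots> \<le> b * pmf (law step (Suc x) s) (Suc x + s)"
  proof (cases "Suc x \<le> m")
    case True
    show ?thesis using b(1) by (intro mult_left_mono Suc.IH True)
  qed (simp add: b_def u_zero)
  also have "\<dots> \<le> pmf (law step x (Suc s)) (x + Suc s)"
    using b prob_law_Suc[of x s "{x + Suc s}"]
    by (simp add: b_def[symmetric] pmf.rep_eq del: law.simps)
  finally show ?case .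
qed

lemma dist_upper:
  assumes "\<And>x. x \<le> m \<Longrightarrow> u (x + s) / u x \<le> B"
  shows "dist_to_stationarity {..m} step stat s \<le> B + (1 - pmf stat 0)"
proof (intro dist_to_stationarity_le tv_dist_le)
  fix x A assume "x \<in> {..m}"
  then show "\<bar>measure_pmf.prob (law step x s) A - measure_pmf.prob stat A\<bar> \<le> B + (1 - pmf stat 0)"
    using prob_law_upper[of x s A] assms[of x] by simp
qed auto

text \<open>The event \<open>{Suc s}\<close> separates the law started at \<open>1\<close> from
  \<open>stat\<close>, which gives it at most the mass off \<open>0\<close>. For
  \<open>Suc s > m\<close> the left side is not positive.\<close>

lemma dist_lower: "u (Suc s) / u 1 - (1 - pmf stat 0) \<le> dist_to_stationarity {..m} step stat s"
proof -
  have *: "\<bar>measure_pmf.prob (law step 1 s) A - measure_pmf.prob stat A\<bar>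
      \<le> dist_to_stationarity {..m} step stat s" if "A \<subseteq> {..m}" for A
    using tv_dist_ge[OF _ that, of "law step 1 s" stat] m_pos
      dist_to_stationarity_ge[of "{..m}" 1 step s stat] by auto
  show ?thesis
  proof (cases "Suc s \<le> m")
    case True
    have "pmf stat 0 + pmf stat (Suc s) = measure_pmf.prob stat {0, Suc s}"
      by (subst measure_measure_pmf_finite) auto
    then have "pmf stat (Suc s) \<le> 1 - pmf stat 0"
      using measure_pmf.prob_le_1[of stat "{0, Suc s}"] by linarith
    then show ?thesis
      using *[of "{Suc s}"] pmf_law_lower[of 1 s] m_pos True by (simp add: pmf.rep_eq)
  next
    case False
    then show ?thesis using *[of "{}"] pmf_le_1[of stat 0] by (simp add: u_zero)
  qed
qed

end

section \<open>From a decay profile to a chain\<close>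

text \<open>Start \<open>1\<close> realizes \<open>q s\<close> itself, while start
  \<open>j + 1\<close> contributes \<open>q (j + s) / q j\<close>; the condition on \<open>B\<close>
  states this ratio bound without division, as \<open>q j\<close> may be 0. The zero of
  \<open>q\<close> makes the state space finite.\<close>

lemma exists_chain_of_profile:
  fixes q :: "nat \<Rightarrow> real"
  assumes q_0: "q 0 = 1" and q_anti: "antimono q" and q_nonneg: "\<And>i. q i \<ge> 0"
    and q_zero: "q k = 0" and \<eta>: "\<eta> > 0"
  obtains S :: "nat set" and K \<pi> where "ergodic_chain S K" "stationary_distribution S K \<pi>"
    "\<And>s. q s - \<eta> \<le> dist_to_stationarity S K \<pi> s"
    "\<And>s B. (\<And>j. q (j + s) \<le> B * q j) \<Longrightarrow> dist_to_stationarity S K \<pi> s \<le> B + 2 * \<eta>"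
proof -
  \<comment> \<open>With the least zero of \<open>q\<close>, the states \<open>1\<close> to
    \<open>m\<close> carry exactly the positive values \<open>q 0\<close> to
    \<open>q (m - 1)\<close>.\<close>
  define m where "m = (LEAST i. q i = 0)"
  have q_m: "q m = 0" unfolding m_def using q_zero by (rule LeastI)
  have m_pos: "m \<ge> 1" using q_m q_0 by (cases m) auto
  have q_pos: "q i > 0" if "i < m" for i
    using q_nonneg[of i] not_less_Least[of i "\<lambda>i. q i = 0"] that by (fastforce simp: m_def)
  have q_above: "q i = 0" if "i \<ge> m" for i
    using antimonoD[OF q_anti that] q_m q_nonneg[of i] by simp
  have q_le_1: "q i \<le> 1" for i using antimonoD[OF q_anti, of 0 i] q_0 by simp
  \<comment> \<open>The \<open>m\<close> states other than \<open>0\<close> have total weight at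
    most \<open>\<epsilon> * m\<close>, hence at most \<eta>; the bound 1/2 ensures
    \<open>u 1 < 1\<close>.\<close>
  define \<epsilon> where "\<epsilon> = min (1/2) (\<eta> / real m)"
  have \<epsilon>: "\<epsilon> > 0" "\<epsilon> \<le> 1/2" "\<epsilon> * real m \<le> \<eta>"
    using m_pos \<eta> by (auto simp: \<epsilon>_def min_def field_simps)
  have "\<epsilon> * 1 \<le> \<epsilon> * real m" using \<epsilon>(1) m_pos by (intro mult_left_mono) auto
  then have \<epsilon>_le: "\<epsilon> \<le> \<eta>" using \<epsilon>(3) by simp
  define u where "u i = (case i of 0 \<Rightarrow> 1 | Suc j \<Rightarrow> \<epsilon> * q j)" for i
  have u_simps: "u 0 = 1" "u (Suc j) = \<epsilon> * q j" for j by (auto simp: u_def)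
  interpret run_chain u m
  proof
    have "u (Suc i) \<le> u i" for i
    proof (cases i)
      case 0
      then show ?thesis using \<epsilon> by (simp add: u_simps q_0)
    next
      case (Suc j)
      then show ?thesis using \<epsilon>(1) antimonoD[OF q_anti, of j "Suc j"] by (simp add: u_simps)
    qed
    then show "antimono u" by (rule decseq_SucI)
    show "u 1 < 1" using \<epsilon> by (simp add: u_simps q_0)
    show "u i > 0" if "i \<le> m" for i using that q_pos \<epsilon>(1) by (cases i) (auto simp: u_simps)
    show "u i = 0" if "i > m" for i using that q_above by (cases i) (auto simp: u_simps)
  qed (use m_pos in \<open>auto simp: u_simps\<close>)
  have "total = 1 + (\<Sum>j<m. \<epsilon> * q j)"
    unfolding total_def by (subst lessThan_Suc_atMost[symmetric])
      (simp add: sum.lessThan_Suc_shift u_simps del: sum.lessThan_Suc)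
  also have "(\<Sum>j<m. \<epsilon> * q j) \<le> (\<Sum>j<m. \<epsilon>)"
    using \<epsilon>(1) q_le_1 by (intro sum_mono) simp
  finally have "total \<le> 1 + \<eta>" using \<epsilon>(3) by (simp add: mult.commute)
  moreover have "1 - 1 / total \<le> total - 1"
  proof -
    have "0 \<le> (total - 1)\<^sup>2 / total" using total_ge_1 by simp
    also have "\<dots> = total - 2 + 1 / total"
      using total_ge_1 by (simp add: field_simps power2_eq_square)
    finally show ?thesis by simp
  qed
  ultimately have stat_0: "1 - pmf stat 0 \<le> \<eta>" by (simp add: pmf_stat u_simps)
  show ?thesis
  proof (rule that[OF ergodic stationary])
    fix s
    show "q s - \<eta> \<le> dist_to_stationarity {..m} step stat s"
      using dist_lower[of s] stat_0 \<epsilon>(1) by (simp add: u_simps q_0)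
    fix B assume B: "\<And>j. q (j + s) \<le> B * q j"
    have B_nonneg: "B \<ge> 0" using B[of 0] q_nonneg[of s] q_0 by simp
    have "dist_to_stationarity {..m} step stat s \<le> (B + \<eta>) + (1 - pmf stat 0)"
    proof (rule dist_upper)
      fix x assume x: "x \<le> m"
      show "u (x + s) / u x \<le> B + \<eta>"
      proof (cases x)
        case (Suc j)
        then have "q j > 0" using x q_pos by simp
        then have "q (j + s) / q j \<le> B" using B[of j] by (simp add: divide_le_eq)
        then show ?thesis using Suc \<epsilon>(1) \<eta> by (simp add: u_simps)
      \<comment> \<open>Start \<open>0\<close> is not covered by a ratio of \<open>q\<close>. For
        \<open>s > 0\<close> its first rise already has probability at most \<epsilon>, which \<eta>
        absorbs; for \<open>s = 0\<close> the ratio is 1, and \<open>B\<close> is at least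
        1.\<close>
      next
        case 0
        show ?thesis
        proof (cases s)
          case 0
          then show ?thesis using \<open>x = 0\<close> B[of 0] q_0 \<eta> by (simp add: u_simps)
        next
          case (Suc r)
          have "\<epsilon> * q r \<le> \<epsilon> * 1" using \<epsilon>(1) q_le_1 by (intro mult_left_mono) auto
          then show ?thesis using \<open>x = 0\<close> Suc \<epsilon>_le B_nonneg by (simp add: u_simps)
        qed
      qed
    qed
    then show "dist_to_stationarity {..m} step stat s \<le> B + 2 * \<eta>" using stat_0 by simp
  qed
qed

section \<open>The truncated profile and its restarts\<close>

definition profile :: "(real \<Rightarrow> real) \<Rightarrow> nat \<Rightarrow> real \<Rightarrow> nat \<Rightarrow> real" where
  "profile p t w s =
    (if s = 0 then 1 else if 2 * s > 3 * t then 0 else p ((real s - real t) / w))"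

context
  fixes p :: "real \<Rightarrow> real" and t :: nat and w :: real
  assumes p_range: "\<And>x. p x \<in> {0..1}" and p_decreasing: "antimono p" and w_pos: "w > 0"
begin

lemma profile_range: "profile p t w s \<in> {0..1}"
  using p_range by (auto simp: profile_def)

lemma profile_antimono: "antimono (profile p t w)"
proof (rule antimonoI)
  fix a b :: nat assume ab: "a \<le> b"
  have "p ((real b - real t) / w) \<le> p ((real a - real t) / w)"
    using ab w_pos by (intro antimonoD[OF p_decreasing] divide_right_mono) auto
  then show "profile p t w b \<le> profile p t w a"
    using ab profile_range[of b] p_range by (auto simp: profile_def)
qed

text \<open>Only the cutoff can lower the profile below \<open>p\<close>, and it acts where the
  rescaled time exceeds \<open>t / (2 * w)\<close>, so that \<open>p\<close> is at most \<delta>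
  there.\<close>

lemma profile_ge:
  assumes "p (real t / (2 * w)) \<le> \<delta>" "\<delta> \<ge> 0"
  shows "p ((real s - real t) / w) - \<delta> \<le> profile p t w s"
proof (cases "2 * s > 3 * t")
  case True
  then have "2 * real s > 3 * real t" by linarith
  then have "real t / (2 * w) \<le> (real s - real t) / w"
    using w_pos by (simp add: field_simps)
  from antimonoD[OF p_decreasing this] show ?thesis
    using assms profile_range[of s] by simp
next
  case False
  then show ?thesis
    using assms(2) p_range[of "(real s - real t) / w"] by (auto simp: profile_def)
qed

text \<open>Restarting the profile at a later time \<open>j\<close> gains nothing: if \<open>p\<close> is not yet near \<open>1\<close> at
  time \<open>s\<close>, the cutoff at \<open>3 t / 2\<close> forces \<open>j\<close> to be so early that the profile is still near \<open>1\<close>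
  there.\<close>

lemma profile_shift_le:
  assumes \<delta>: "0 < \<delta>" "\<delta> \<le> 1/2" and A: "\<And>x. x \<le> - A \<Longrightarrow> p x \<ge> 1 - \<delta>"
    and large: "4 * A * w \<le> real t"
  shows "profile p t w (j + s) \<le> (p ((real s - real t) / w) + 2 * \<delta>) * profile p t w j"
proof -
  let ?P = "\<lambda>s. p ((real s - real t) / w)" and ?q = "profile p t w"
  have q: "0 \<le> ?q i" "?q i \<le> 1" for i using profile_range[of i] by auto
  have P: "0 \<le> ?P i" "?P i \<le> 1" for i using p_range[of "(real i - real t) / w"] by auto
  show ?thesis
  proof (cases "?P s \<ge> 1 - \<delta> \<or> ?q (j + s) = 0")
    \<comment> \<open>If \<open>p\<close> is within \<delta> of 1 at time \<open>s\<close>, the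
      factor is at least 1 and monotonicity suffices; beyond the cutoff the left side is 0.\<close>
    case True
    then show ?thesis
    proof
      assume "?P s \<ge> 1 - \<delta>"
      then have "1 * ?q j \<le> (?P s + 2 * \<delta>) * ?q j" using q \<delta> by (intro mult_right_mono) auto
      then show ?thesis using antimonoD[OF profile_antimono, of j "j + s"] by simp
    qed (use q P \<delta> in simp)
  next
    case False
    have "\<not> (real s - real t) / w \<le> - A" using A False by blast
    then have s: "real s > real t - A * w" using w_pos by (simp add: field_simps)
    moreover have "4 * (A * w) \<le> real t" using large by simp
    \<comment> \<open>At \<open>s = 0\<close> the profile is set to 1 and could exceed
      \<open>p\<close>, so this case must be excluded.\<close>
    ultimately have s_pos: "s > 0" by (cases "s = 0") auto
    then have "2 * (j + s) \<le> 3 * t" using False by (auto simp: profile_def split: if_splits)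
    then have "2 * real j + 2 * real s \<le> 3 * real t"
      using of_nat_mono[of "2 * (j + s)" "3 * t", where 'a=real] by simp
    \<comment> \<open>From \<open>j + s \<le> 3 t / 2\<close> and \<open>s > t - A w\<close> follows
      \<open>j < t / 2 + A w\<close>, and \<open>4 A w \<le> t\<close> turns this into
      \<open>j \<le> t - A w\<close>.\<close>
    then have "real j - real t \<le> - A * w" using s large by (simp add: algebra_simps)
    then have "(real j - real t) / w \<le> - A" using w_pos by (simp add: field_simps)
    from A[OF this] have qj: "1 - \<delta> \<le> ?q j"
      using \<delta> \<open>2 * (j + s) \<le> 3 * t\<close> by (auto simp: profile_def)
    have "?q (j + s) \<le> ?q s" by (intro antimonoD[OF profile_antimono]) simp
    also have "\<dots> \<le> ?P s" using s_pos P by (simp add: profile_def)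
    also have "\<dots> \<le> (?P s + 2 * \<delta>) * (1 - \<delta>)"
    proof -
      have "\<delta> * ?P s \<le> \<delta> * 1" "\<delta> * \<delta> \<le> \<delta> * (1/2)" using P \<delta> by (intro mult_left_mono; simp)+
      then show ?thesis by (simp add: algebra_simps)
    qed
    also have "\<dots> \<le> (?P s + 2 * \<delta>) * ?q j" using qj P \<delta> by (intro mult_left_mono) auto
    finally show ?thesis .
  qed
qed

end

section \<open>Choice of the chains and the uniform limit\<close>

theorem theorem1p7:
  fixes t :: "nat \<Rightarrow> nat" and w :: "nat \<Rightarrow> real" and p :: "real \<Rightarrow> real"
  assumes t_pos: "\<And>n. n \<ge> 1 \<Longrightarrow> t n > 0"
    and w_pos: "\<And>n. n \<ge> 1 \<Longrightarrow> w n > 0"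
    and ratio: "(\<lambda>n. w n / real (t n)) \<longlonglongrightarrow> 0"
    and p_range: "\<And>x. p x \<in> {0..1}"
    and p_decreasing: "antimono p"
    and p_at_bot: "(p \<longlongrightarrow> 1) at_bot"
    and p_at_top: "(p \<longlongrightarrow> 0) at_top"
  shows "\<exists>(S :: nat \<Rightarrow> nat set) (K :: nat \<Rightarrow> nat \<Rightarrow> nat pmf) (\<pi> :: nat \<Rightarrow> nat pmf).
      (\<forall>n\<ge>1. ergodic_chain (S n) (K n) \<and> stationary_distribution (S n) (K n) (\<pi> n)) \<and>
      (\<lambda>n. SUP c\<in>{c :: real. real (t n) + c * w n \<in> \<nat>}.
          \<bar>dist_to_stationarity (S n) (K n) (\<pi> n) (nat \<lfloor>real (t n) + c * w n\<rfloor>) - p c\<bar>)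
        \<longlonglongrightarrow> 0"
proof -
  define q where "q n = profile p (t n) (w n)" for n
  define \<eta> :: "nat \<Rightarrow> real" where "\<eta> n = 1 / real (Suc n)" for n
  \<comment> \<open>Bundling all guarantees in one predicate allows \<open>S\<close>,
    \<open>K\<close> and \<pi> to be chosen simultaneously for every
    \<open>n \<ge> 1\<close>.\<close>
  define good where "good n S K \<pi> \<longleftrightarrow> ergodic_chain S K \<and> stationary_distribution S K \<pi> \<and>
      (\<forall>s. q n s - \<eta> n \<le> dist_to_stationarity S K \<pi> s) \<and>
      (\<forall>s B. (\<forall>j. q n (j + s) \<le> B * q n j) \<longrightarrow> dist_to_stationarity S K \<pi> s \<le> B + 2 * \<eta> n)"
    for n K \<pi> and S :: "nat set"
  have "\<exists>S K \<pi>. good n S K \<pi>"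
    if n: "n \<ge> 1" for n
  proof -
    \<comment> \<open>The value 1 that \<open>profile\<close> takes at time \<open>0\<close> by
      definition is needed here, as \<open>p\<close> need not reach 1; time \<open>2 t + 1\<close>
      lies beyond the cutoff.\<close>
    have 1: "q n 0 = 1" "q n (Suc (2 * t n)) = 0" "\<eta> n > 0"
      by (auto simp: q_def profile_def \<eta>_def)
    have 2: "antimono (q n)"
      unfolding q_def by (intro profile_antimono p_range p_decreasing w_pos n)
    have 3: "q n i \<ge> 0" for i
      using profile_range[OF p_range p_decreasing w_pos[OF n]] by (auto simp: q_def)
    show ?thesis
    proof (rule exists_chain_of_profile[OF 1(1) 2 3 1(2,3)])
      fix S :: "nat set" and K \<pi>
      assume "ergodic_chain S K" "stationary_distribution S K \<pi>"
        "\<And>s. q n s - \<eta> n \<le> dist_to_stationarity S K \<pi> s"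
        "\<And>s B. (\<And>j. q n (j + s) \<le> B * q n j) \<Longrightarrow> dist_to_stationarity S K \<pi> s \<le> B + 2 * \<eta> n"
      then have "good n S K \<pi>" unfolding good_def by simp
      then show ?thesis by blast
    qed
  qed
  then obtain S K \<pi> where good: "\<And>n. n \<ge> 1 \<Longrightarrow> good n (S n) (K n) (\<pi> n)"
    by metis
  note chain = good[unfolded good_def, THEN conjunct1]
    and stat = good[unfolded good_def, THEN conjunct2, THEN conjunct1]
    and lower = good[unfolded good_def, THEN conjunct2, THEN conjunct2, THEN conjunct1, rule_format]
    and upper = good[unfolded good_def, THEN conjunct2, THEN conjunct2, THEN conjunct2, rule_format]
  define err where "err n c =
    \<bar>dist_to_stationarity (S n) (K n) (\<pi> n) (nat \<lfloor>real (t n) + c * w n\<rfloor>) - p c\<bar>" for n c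
  \<comment> \<open>The bound is uniform in \<open>c\<close>. Below, the loss is \<delta> from the
    cutoff plus \<open>\<eta> n\<close>; above, it is \<open>2 * \<delta>\<close> from restarts plus
    \<open>2 * \<eta> n\<close>. Eventually \<open>\<eta> n < \<delta>\<close>, so
    \<open>4 * \<delta>\<close> covers both.\<close>
  have err_le: "\<forall>\<^sub>F n in sequentially. \<forall>c. real (t n) + c * w n \<in> \<nat> \<longrightarrow> err n c \<le> 4 * \<delta>"
    if \<delta>: "0 < \<delta>" "\<delta> \<le> 1/2" for \<delta>
  proof -
    have "\<forall>\<^sub>F x in at_bot. p x > 1 - \<delta>" using p_at_bot \<delta> by (intro order_tendstoD) auto
    then obtain a where a: "\<And>x. x \<le> a \<Longrightarrow> p x > 1 - \<delta>" by (auto simp: eventually_at_bot_linorder)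
    have "\<forall>\<^sub>F x in at_top. p x < \<delta>" using p_at_top \<delta> by (intro order_tendstoD) auto
    then obtain b where b: "\<And>x. x \<ge> b \<Longrightarrow> p x < \<delta>" by (auto simp: eventually_at_top_linorder)
    \<comment> \<open>One threshold serves both tails: \<open>p\<close> is near 1 left of
      \<open>- A\<close> and near 0 right of \<open>A\<close>. The 1 keeps \<open>A\<close>
      positive, so that \<open>1 / (4 * A)\<close> is a valid bound for
      \<open>w n / t n\<close>.\<close>
    define A where "A = max 1 (max \<bar>a\<bar> \<bar>b\<bar>)"
    have A: "A > 0" "A \<ge> b" "- A \<le> a" by (auto simp: A_def)
    have "\<forall>\<^sub>F n in sequentially. w n / real (t n) < 1 / (4 * A)"
      using ratio A by (intro order_tendstoD) auto
    moreover have "\<forall>\<^sub>F n in sequentially. \<eta> n < \<delta>"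
      unfolding \<eta>_def using LIMSEQ_Suc[OF lim_1_over_n] \<delta> by (intro order_tendstoD) auto
    moreover have "\<forall>\<^sub>F n in sequentially. n \<ge> (1::nat)" by (rule eventually_ge_at_top)
    ultimately show ?thesis
    proof eventually_elim
      case (elim n)
      have pos: "w n > 0" "real (t n) > 0" using elim w_pos t_pos by auto
      have large: "4 * A * w n \<le> real (t n)" using elim pos A by (simp add: field_simps)
      then have "A \<le> real (t n) / (2 * w n)"
        using pos A mult_pos_pos[OF A(1) pos(1)] by (simp add: field_simps)
      then have top: "p (real (t n) / (2 * w n)) \<le> \<delta>" using b A(2) less_imp_le order_trans by blast
      show ?case
      proof (intro allI impI)
        fix c assume "real (t n) + c * w n \<in> \<nat>"
        \<comment> \<open>At such \<open>c\<close> the floor is exact, and the rescaled time of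
          \<open>s\<close> is \<open>c\<close> itself.\<close>
        then obtain s where s: "real (t n) + c * w n = real s" by (auto elim: Nats_cases)
        then have c: "(real s - real (t n)) / w n = c" using pos by (simp add: field_simps)
        let ?d = "dist_to_stationarity (S n) (K n) (\<pi> n) s"
        have "p c - \<delta> \<le> q n s"
          using profile_ge[OF p_range p_decreasing pos(1) top, of s] \<delta> c by (simp add: q_def)
        moreover have "?d \<le> (p c + 2 * \<delta>) + 2 * \<eta> n"
        proof (rule upper)
          show "q n (j + s) \<le> (p c + 2 * \<delta>) * q n j" for j
            unfolding q_def c[symmetric] using A(3)
            by (intro profile_shift_le[OF p_range p_decreasing pos(1) \<delta> _ large])
               (auto intro!: less_imp_le[OF a])
        qed (use elim in simp)
        moreover have "q n s - \<eta> n \<le> ?d" using lower elim by simp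
        ultimately show "err n c \<le> 4 * \<delta>"
          using elim \<delta> by (simp add: err_def s abs_le_iff)
      qed
    qed
  qed
  have "(\<lambda>n. SUP c\<in>{c. real (t n) + c * w n \<in> \<nat>}. err n c) \<longlonglongrightarrow> 0"
  proof (rule tendstoI)
    fix e :: real assume e: "e > 0"
    define \<delta> where "\<delta> = min (1/2) (e / 8)"
    have \<delta>: "0 < \<delta>" "\<delta> \<le> 1/2" "4 * \<delta> < e" using e by (auto simp: \<delta>_def)
    from err_le[OF \<delta>(1,2)]
    show "\<forall>\<^sub>F n in sequentially. dist (SUP c\<in>{c. real (t n) + c * w n \<in> \<nat>}. err n c) 0 < e"
    proof eventually_elim
      case (elim n)
      let ?C = "{c. real (t n) + c * w n \<in> \<nat>}"
      \<comment> \<open>The point \<open>c = 0\<close> makes the index set nonempty and bounds the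
        supremum below by \<open>err n 0 \<ge> 0\<close>.\<close>
      have 0: "0 \<in> ?C" by simp
      have "(SUP c\<in>?C. err n c) \<le> 4 * \<delta>" using elim 0 by (intro cSUP_least) blast+
      moreover have "err n 0 \<le> (SUP c\<in>?C. err n c)"
        using elim 0 by (intro cSUP_upper) (auto intro!: bdd_aboveI[of _ "4 * \<delta>"])
      moreover have "err n 0 \<ge> 0" by (simp add: err_def)
      ultimately show ?case using \<delta>(3) by simp
    qed
  qed
  then show ?thesis using chain stat unfolding err_def by blast
qed

end
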